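(* Let $u,v\in\ell^+$ and $A\in[0,\infty)$. Consider the statements \begin{align*} (1)\quad &\|Cx\|_{\ell^\infty(v)}\le A\|C^*x\|_{\ell^\infty(1/u)}\quad\text{for all } x\in\mathcal D(C^* );\\ (2)\quad &\|(C-S^* )y\|_{\ell^\infty(v)}\le A\|y\|_{\ell^\infty(1/u)}\quad\text{for all } y\in\ell \text{ with } y_n\to0;\\ (3)\quad &\|Cx\|_{\ell^\infty(v)}\le A\|C^*x\|_{\ell^\infty(1/u)}\quad\text{for all } x\in\ell^+\cap\mathcal D(C^* );\\ (4)\quad &\|(C-S^* )y\|_{\ell^\infty(v)}\le A\|y\|_{\ell^\infty(1/u)}\quad\text{for all } y\in\ell^\downarrow \text{ with } y_n\to0. \end{align*} Then (1) holds if and only if (2) holds, and (3) holds if and only if (4) holds.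
   Context: $\ell$ is the set of all real sequences indexed by the positive integers, $\ell^+$ the set of nonnegative real sequences, $\ell^\downarrow$ the set of nonincreasing sequences of nonnegative real numbers. $(Cx)_n=\frac1n\sum_{k=1}^n x_k$; $(C^*x)_n=\sum_{k=n}^\infty \frac{x_k}{k}$, with domain $\mathcal D(C^* )$ the set of all $x\in\ell$ for which $\sum_{k=1}^\infty \frac{x_k}{k}$ converges (possibly conditionally) in $\mathbb R$; $(S^*y)_n=y_{n+1}$. For $u,v\in\ell^+$ and real sequences $x,y$: $\|y\|_{\ell^\infty(v)}=\sup_n|y_n|v_n\in[0,\infty]$ and $\|x\|_{\ell^\infty(1/u)}=\sup_k|x_k|/u_k\in[0,\infty]$, where, if $u_k=0$, $|x_k|/u_k$ is $0$ when $x_k=0$ and $\infty$ when $x_k\neq0$. An inequality of the form $\|\cdot\|\le A\|\cdot\|$ is regarded as holding whenever the norm on the right-hand side is $\infty$ (even if $A=0$). *)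

theory Defs
  imports "HOL-Analysis.Analysis"
begin

(* A real sequence indexed by the positive integers is a function of type
   "nat \<Rightarrow> real" whose value at 0 is a dummy: no notion below looks at it
   when evaluated at positive indices, and all suprema and side conditions
   range over the indices n \<ge> 1 only. *)

definition nonneg_seqs :: "(nat \<Rightarrow> real) set" where
  "nonneg_seqs = {x. \<forall>n\<ge>1. 0 \<le> x n}"

definition noninc_seqs :: "(nat \<Rightarrow> real) set" where
  "noninc_seqs = {x. (\<forall>n\<ge>1. 0 \<le> x n) \<and> (\<forall>n\<ge>1. x (Suc n) \<le> x n)}"

definition Ces :: "(nat \<Rightarrow> real) \<Rightarrow> nat \<Rightarrow> real" where
  "Ces x n = (1 / real n) * (\<Sum>k=1..n. x k)"

definition Cop :: "(nat \<Rightarrow> real) \<Rightarrow> nat \<Rightarrow> real" where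
  "Cop x n = (\<Sum>j. x (n + j) / real (n + j))"

(* "summable" is convergence of the partial sums, so conditional convergence is allowed. *)
definition dom_Cop :: "(nat \<Rightarrow> real) set" where
  "dom_Cop = {x. summable (\<lambda>j. x (Suc j) / real (Suc j))}"

definition bshift :: "(nat \<Rightarrow> real) \<Rightarrow> nat \<Rightarrow> real" where
  "bshift y n = y (Suc n)"

definition norm_mult :: "(nat \<Rightarrow> real) \<Rightarrow> (nat \<Rightarrow> real) \<Rightarrow> ennreal" where
  "norm_mult v y = (SUP n\<in>{1..}. ennreal (\<bar>y n\<bar> * v n))"

(* The division is the one of "ennreal", where 0 / 0 = 0 and a / 0 = \<infinity>
   for a \<noteq> 0; see the lemma that follows. *)
definition norm_div :: "(nat \<Rightarrow> real) \<Rightarrow> (nat \<Rightarrow> real) \<Rightarrow> ennreal" where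
  "norm_div u x = (SUP k\<in>{1..}. ennreal \<bar>x k\<bar> / ennreal (u k))"

lemma norm_div_term:
  assumes "0 \<le> b"
  shows "ennreal \<bar>a\<bar> / ennreal b =
    (if b = 0 then (if a = 0 then 0 else \<infinity>) else ennreal (\<bar>a\<bar> / b))"
  using assms by (auto simp: divide_ennreal ennreal_divide_eq_top_iff)

(* N \<le> A M, regarded as true when M = \<infinity>.  The disjunct matters only for
   A = 0, because 0 * \<infinity> = 0 in "ennreal". *)
definition bounded_by :: "ennreal \<Rightarrow> real \<Rightarrow> ennreal \<Rightarrow> bool" where
  "bounded_by N A M \<longleftrightarrow> M = \<infinity> \<or> N \<le> ennreal A * M"

end

theory Submission
  imports Defs
begin

text \<open>
  The map \<open>x \<mapsto> C\<^sup>* x\<close> is a bijection from its domain onto the null sequences: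
  \<open>y = C\<^sup>* x\<close> is the sequence of tails of the series \<open>\<Sum> x\<^sub>k / k\<close>, so it tends to \<open>0\<close> and its
  differences recover the terms, \<open>x\<^sub>k = k (y\<^sub>k - y\<^sub>k\<^sub>+\<^sub>1)\<close>; conversely, if \<open>y\<close> is any null sequence and
  \<open>x\<close> is defined by that formula, then the series telescopes, so \<open>x\<close> lies in the domain and
  \<open>C\<^sup>* x = y\<close>.  Under this bijection, summation by parts turns \<open>C x\<close> into \<open>(C - S\<^sup>*) y\<close>, whence
  the inequality for \<open>x\<close> is literally the inequality for \<open>y\<close>, constant included.
  Moreover, \<open>x \<ge> 0\<close> says that \<open>y\<close> is nonincreasing (and a nonincreasing null
  sequence is nonnegative), so the same substitution handles the two restricted statements.

  The bijection is given by \<open>tails_Cop\<close>, \<open>tails_imp_dom_Cop\<close> and \<open>tails_imp_Cop_eq\<close>, the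
  transformation of \<open>C\<close> by \<open>tails_imp_Ces_eq\<close>, and the matching of the two cones by
  \<open>tails_imp_nonneg_iff_noninc\<close>.
\<close>

text \<open>The graph of the bijection \<open>x \<mapsto> C\<^sup>* x\<close>.  It is a relation because the values at the dummy
  index \<open>0\<close> are unconstrained, so that \<open>x\<close> and \<open>y\<close> determine each other only at positive
  indices.\<close>

definition tails :: "(nat \<Rightarrow> real) \<Rightarrow> (nat \<Rightarrow> real) \<Rightarrow> bool" where
  "tails x y \<longleftrightarrow> (\<forall>k\<ge>1. x k = real k * (y k - y (Suc k))) \<and> y \<longlonglongrightarrow> 0"

lemma norm_mult_cong:
  assumes "\<And>n. n \<ge> 1 \<Longrightarrow> y n = z n"
  shows "norm_mult v y = norm_mult v z"
  unfolding norm_mult_def using assms by (intro SUP_cong) auto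

lemma norm_div_cong:
  assumes "\<And>n. n \<ge> 1 \<Longrightarrow> y n = z n"
  shows "norm_div u y = norm_div u z"
  unfolding norm_div_def using assms by (intro SUP_cong) auto

lemma tails_weighted_differences:
  assumes "y \<longlonglongrightarrow> 0"
  shows "tails (\<lambda>k. real k * (y k - y (Suc k))) y"
  using assms by (simp add: tails_def)

text \<open>The series defining \<open>C\<^sup>* x\<close> telescopes, and its limit is determined by \<open>y\<^sub>n \<rightarrow> 0\<close>.\<close>

lemma tails_sums:
  assumes "tails x y" "n \<ge> 1"
  shows "(\<lambda>j. x (n + j) / real (n + j)) sums y n"
proof -
  have "y \<longlonglongrightarrow> 0" using assms by (simp add: tails_def)
  then have "(\<lambda>j. y (n + j)) \<longlonglongrightarrow> 0"
    using LIMSEQ_ignore_initial_segment[of y 0 n] by (simp add: add.commute)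
  from telescope_sums'[OF this]
  have "(\<lambda>j. y (n + j) - y (Suc (n + j))) sums y n" by simp
  moreover have "x (n + j) / real (n + j) = y (n + j) - y (Suc (n + j))" for j
    using assms by (simp add: tails_def del: of_nat_add)
  ultimately show ?thesis by simp
qed

lemma tails_imp_dom_Cop: "tails x y \<Longrightarrow> x \<in> dom_Cop"
  using tails_sums[of x y 1] by (auto simp: dom_Cop_def sums_iff)

lemma tails_imp_Cop_eq: "tails x y \<Longrightarrow> n \<ge> 1 \<Longrightarrow> Cop x n = y n"
  using tails_sums[of x y n] by (simp add: Cop_def sums_iff)

lemma tails_Cop:
  assumes "x \<in> dom_Cop"
  shows "tails x (Cop x)"
proof -
  define f where "f = (\<lambda>k. x k / real k)"
  have "summable (\<lambda>j. f (Suc j))" using assms by (simp add: dom_Cop_def f_def)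
  then have f: "summable f" by (simp only: summable_Suc_iff)
  have Cop: "Cop x n = (\<Sum>j. f (j + n))" for n
    by (simp add: Cop_def f_def add.commute)
  have "Cop x k - Cop x (Suc k) = f k" for k
    using suminf_split_head[of "\<lambda>j. f (j + k)"] f by (simp add: Cop)
  moreover have "Cop x \<longlonglongrightarrow> 0"
    using suminf_exist_split2[OF f] by (simp add: Cop[abs_def])
  ultimately show ?thesis by (simp add: tails_def f_def)
qed

text \<open>Summation by parts: the weights \<open>k\<close> increase by one at each step, so the boundary
  term \<open>n y\<^sub>n\<^sub>+\<^sub>1\<close> is what remains beside the plain sum of the \<open>y\<^sub>k\<close>.\<close>

lemma tails_imp_Ces_eq:
  assumes "tails x y" "n \<ge> 1"
  shows "Ces x n = Ces y n - bshift y n"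
proof -
  have "(\<Sum>k=1..m. x k) = (\<Sum>k=1..m. y k) - real m * y (Suc m)" for m
  proof (induction m)
    case (Suc m)
    have "x (Suc m) = real (Suc m) * (y (Suc m) - y (Suc (Suc m)))"
      using assms(1) by (simp add: tails_def)
    with Suc.IH show ?case by (simp add: algebra_simps)
  qed simp
  with assms(2) show ?thesis
    by (simp add: Ces_def bshift_def field_simps)
qed

lemma tails_imp_bounded_by_iff:
  assumes "tails x y"
  shows "bounded_by (norm_mult v (Ces x)) A (norm_div u (Cop x)) \<longleftrightarrow>
         bounded_by (norm_mult v (\<lambda>n. Ces y n - bshift y n)) A (norm_div u y)"
  using norm_mult_cong[OF tails_imp_Ces_eq[OF assms]]
    norm_div_cong[OF tails_imp_Cop_eq[OF assms]]
  by simp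

text \<open>The weights \<open>k\<close> are positive, so the sign of \<open>x\<^sub>k\<close> is that of \<open>y\<^sub>k - y\<^sub>k\<^sub>+\<^sub>1\<close>; the
  nonnegativity of \<open>y\<close> then comes from its decrease to the limit \<open>0\<close>.\<close>

lemma tails_imp_nonneg_iff_noninc:
  assumes "tails x y"
  shows "x \<in> nonneg_seqs \<longleftrightarrow> y \<in> noninc_seqs"
proof
  assume "y \<in> noninc_seqs"
  then show "x \<in> nonneg_seqs"
    using assms by (simp add: tails_def nonneg_seqs_def noninc_seqs_def)
next
  assume x: "x \<in> nonneg_seqs"
  have step: "y (Suc k) \<le> y k" if "k \<ge> 1" for k
  proof -
    have "0 \<le> real k * (y k - y (Suc k))"
      using x assms that by (simp add: tails_def nonneg_seqs_def)
    with that show ?thesis by (simp add: zero_le_mult_iff)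
  qed
  have "decseq (\<lambda>j. y (Suc j))" using step by (simp add: decseq_Suc_iff)
  moreover have "(\<lambda>j. y (Suc j)) \<longlonglongrightarrow> 0"
    using assms LIMSEQ_Suc[of y 0] by (simp add: tails_def)
  ultimately have "0 \<le> y (Suc j)" for j by (rule decseq_ge)
  then have "0 \<le> y n" if "n \<ge> 1" for n
    using that by (cases n) simp_all
  with step show "y \<in> noninc_seqs" by (simp add: noninc_seqs_def)
qed

theorem theorem2p3:
  fixes u v :: "nat \<Rightarrow> real" and A :: real
  assumes "u \<in> nonneg_seqs" and "v \<in> nonneg_seqs" and "0 \<le> A"
  shows "((\<forall>x \<in> dom_Cop. bounded_by (norm_mult v (Ces x)) A (norm_div u (Cop x)))
          \<longleftrightarrow>
          (\<forall>y :: nat \<Rightarrow> real. y \<longlonglongrightarrow> 0 \<longrightarrow>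
             bounded_by (norm_mult v (\<lambda>n. Ces y n - bshift y n)) A (norm_div u y)))
       \<and> ((\<forall>x \<in> nonneg_seqs \<inter> dom_Cop. bounded_by (norm_mult v (Ces x)) A (norm_div u (Cop x)))
          \<longleftrightarrow>
          (\<forall>y \<in> noninc_seqs. y \<longlonglongrightarrow> 0 \<longrightarrow>
             bounded_by (norm_mult v (\<lambda>n. Ces y n - bshift y n)) A (norm_div u y)))"
    (is "((\<forall>x \<in> _. ?P x) \<longleftrightarrow> (\<forall>y. _ \<longrightarrow> ?Q y)) \<and> _")
proof -
  have PQ: "?P x \<longleftrightarrow> ?Q y" if "tails x y" for x y
    using that by (rule tails_imp_bounded_by_iff)
  have from_x: "?P x" if "x \<in> dom_Cop" "?Q (Cop x)" for x
    using PQ[OF tails_Cop[OF that(1)]] that(2) by blast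
  have Cop_null: "Cop x \<longlonglongrightarrow> 0" if "x \<in> dom_Cop" for x
    using tails_Cop[OF that] by (simp add: tails_def)
  let ?x = "\<lambda>y k. real k * (y k - y (Suc k))"
  have from_y: "?Q y" if "y \<longlonglongrightarrow> 0" "?P (?x y)" for y
    using PQ[OF tails_weighted_differences[OF that(1)]] that(2) by blast
  have dom_x: "?x y \<in> dom_Cop" if "y \<longlonglongrightarrow> 0" for y
    using tails_imp_dom_Cop[OF tails_weighted_differences[OF that]] .
  have noninc_Cop: "Cop x \<in> noninc_seqs" if "x \<in> nonneg_seqs" "x \<in> dom_Cop" for x
    using tails_imp_nonneg_iff_noninc[OF tails_Cop[OF that(2)]] that(1) by blast
  have nonneg_x: "?x y \<in> nonneg_seqs" if "y \<in> noninc_seqs" "y \<longlonglongrightarrow> 0" for y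
    using tails_imp_nonneg_iff_noninc[OF tails_weighted_differences[OF that(2)]] that(1) by blast
  have "(\<forall>x \<in> dom_Cop. ?P x) \<longleftrightarrow> (\<forall>y. y \<longlonglongrightarrow> 0 \<longrightarrow> ?Q y)"
  proof (intro iffI ballI allI impI)
    fix y :: "nat \<Rightarrow> real"
    assume P: "\<forall>x \<in> dom_Cop. ?P x" and y: "y \<longlonglongrightarrow> 0"
    show "?Q y" by (rule from_y[OF y bspec[OF P dom_x[OF y]]])
  next
    fix x
    assume Q: "\<forall>y. y \<longlonglongrightarrow> 0 \<longrightarrow> ?Q y" and x: "x \<in> dom_Cop"
    show "?P x" by (rule from_x[OF x Q[rule_format, OF Cop_null[OF x]]])
  qed
  moreover have "(\<forall>x \<in> nonneg_seqs \<inter> dom_Cop. ?P x) \<longleftrightarrow>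
      (\<forall>y \<in> noninc_seqs. y \<longlonglongrightarrow> 0 \<longrightarrow> ?Q y)"
  proof (intro iffI ballI impI)
    fix y
    assume P: "\<forall>x \<in> nonneg_seqs \<inter> dom_Cop. ?P x" and y: "y \<in> noninc_seqs" "y \<longlonglongrightarrow> 0"
    show "?Q y"
      by (rule from_y[OF y(2) bspec[OF P IntI[OF nonneg_x[OF y] dom_x[OF y(2)]]]])
  next
    fix x
    assume Q: "\<forall>y \<in> noninc_seqs. y \<longlonglongrightarrow> 0 \<longrightarrow> ?Q y" and x: "x \<in> nonneg_seqs \<inter> dom_Cop"
    then have x': "x \<in> nonneg_seqs" "x \<in> dom_Cop" by simp_all
    show "?P x"
      by (rule from_x[OF x'(2) Q[rule_format, OF noninc_Cop[OF x'] Cop_null[OF x'(2)]]])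
  qed
  ultimately show ?thesis by blast
qed

end
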